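(* Let $J(v,3)$ (with $v\ge 6$) be the Johnson graph, with $n=\binom v3$ vertices, and let $k$ and $m_i$ ($i=1,\ldots,k$) be positive integers such that $\sum_{i=1}^k m_i=n$. Then the semidefinite programming bound $\mathrm{GPP}_{\mathrm m}$ for the minimum graph partition problem of $J(v,3)$ is equal to the optimal value of the linear programming problem $$\begin{array}{ll}\min & \frac32\binom v3(v-3)(1-y_1)\\ \text{s.t.} & A_{eq}\,y=b_{eq}\\ & A_{neq}\,y\ge b_{neq}\\ & y\ge 0,\ y=(y_1,y_2,y_3)^{\mathrm T}\in\mathbb R^3,\end{array}$$ where $$A_{eq}=\Big(3(v-3),\ 3\tbinom{v-3}{2},\ \tbinom{v-3}{3}\Big),\qquad A_{neq}=\begin{pmatrix}2v-9&\frac12(v^2-13v+36)&\frac12(-v^2+9v-20)\\ v-7&-2v+11&v-5\\ -3&3&-1\end{pmatrix},$$ $$b_{eq}=\frac1n\sum_{i=1}^k m_i^2-1,\qquad b_{neq}=-(1,1,1)^{\mathrm T}.$$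
   Context: Let $\Omega$ be a set of size $v$ and let $d$ be an integer with $1\le d\le v/2$; here $d=3$, so $v\ge 6$. The Johnson graph $J(v,3)$ has as vertices the $3$-subsets of $\Omega$, two of them being adjacent when they intersect in exactly $2$ elements. For a graph on $n$ vertices with adjacency matrix $A$ and part sizes $m_1,\dots,m_k$, the bound $\mathrm{GPP}_{\mathrm m}$ for the minimum graph partition problem (partition the vertex set into $k$ sets of sizes $m_1,\dots,m_k$ minimizing the number of edges joining different sets) is the optimal value of $$\min\ \tfrac12\operatorname{tr}A(J_n-Y)\quad\text{s.t.}\quad \operatorname{diag}(Y)=u_n,\ \ \operatorname{tr}J_nY=\sum_{i=1}^k m_i^2,\ \ kY-J_n\succeq 0,\ \ Y\ge 0\ \text{(entrywise)},$$ over real symmetric $n\times n$ matrices $Y$, where $J_n$ is the all-ones matrix, $u_n$ the all-ones vector, and $\operatorname{diag}(Y)$ the vector of diagonal entries of $Y$. Vector inequalities are componentwise. *)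

theory Defs
  imports "HOL-Analysis.Analysis"
begin

text \<open>
  An \<open>n\<close>-vertex graph has its vertices labelled by a finite type \<open>'n\<close> with \<open>CARD('n) = n\<close>, so that
  its adjacency matrix has the library type \<^typ>\<open>real^'n^'n\<close>.
\<close>

definition adjacency_matrix :: "('n \<Rightarrow> 'n \<Rightarrow> bool) \<Rightarrow> real^'n^'n" where
  "adjacency_matrix E = (\<chi> i j. if E i j then 1 else 0)"

definition johnson_vertices :: "'a set \<Rightarrow> nat \<Rightarrow> 'a set set" where
  "johnson_vertices \<Omega> d = {S. S \<subseteq> \<Omega> \<and> card S = d}"

text \<open>For \<open>d-1\<close> and irreflexivity on \<open>d\<close>-sets to be as intended, \<open>d \<ge> 1\<close> is required.\<close>

definition johnson_adj :: "nat \<Rightarrow> 'a set \<Rightarrow> 'a set \<Rightarrow> bool" where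
  "johnson_adj d S T \<longleftrightarrow> card (S \<inter> T) = d - 1"

definition all_ones_matrix :: "real^'n^'n" where
  "all_ones_matrix = (\<chi> i j. 1)"

definition symmetric_matrix :: "real^'n^'n \<Rightarrow> bool" where
  "symmetric_matrix M \<longleftrightarrow> transpose M = M"

definition positive_semidefinite :: "real^'n^'n \<Rightarrow> bool" where
  "positive_semidefinite M \<longleftrightarrow> symmetric_matrix M \<and> (\<forall>x. 0 \<le> x \<bullet> (M *v x))"

text \<open>
  The optimal value of a minimization problem is stated as a relation: it holds only for an attained
  minimum, and for at most one \<open>z\<close>. An infeasible or unbounded problem has no optimal value.
\<close>

definition is_optimal_value :: "('b \<Rightarrow> real) \<Rightarrow> 'b set \<Rightarrow> real \<Rightarrow> bool" where
  "is_optimal_value f F z \<longleftrightarrow> (\<exists>x\<in>F. f x = z) \<and> (\<forall>x\<in>F. z \<le> f x)"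

definition gpp_objective :: "real^'n^'n \<Rightarrow> real^'n^'n \<Rightarrow> real" where
  "gpp_objective A Y = 1/2 * trace (A ** (all_ones_matrix - Y))"

text \<open>The part sizes are \<open>m 1, \<dots>, m k\<close>; values of \<open>m\<close> outside \<open>{1..k}\<close> are irrelevant.\<close>

definition gpp_feasible :: "nat \<Rightarrow> (nat \<Rightarrow> nat) \<Rightarrow> (real^'n^'n) set" where
  "gpp_feasible k m =
     {Y. symmetric_matrix Y \<and>
         (\<forall>i. Y $ i $ i = 1) \<and>
         trace (all_ones_matrix ** Y) = (\<Sum>i=1..k. (real (m i))\<^sup>2) \<and>
         positive_semidefinite (real k *\<^sub>R Y - all_ones_matrix) \<and>
         (\<forall>i j. 0 \<le> Y $ i $ j)}"

definition is_GPPm :: "real^'n^'n \<Rightarrow> nat \<Rightarrow> (nat \<Rightarrow> nat) \<Rightarrow> real \<Rightarrow> bool" where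
  "is_GPPm A k m z \<longleftrightarrow> is_optimal_value (gpp_objective A) (gpp_feasible k m) z"

definition lp_objective :: "nat \<Rightarrow> real^3 \<Rightarrow> real" where
  "lp_objective v y = 3/2 * real (v choose 3) * (real v - 3) * (1 - y $ 1)"

definition lp_A_eq :: "nat \<Rightarrow> real^3" where
  "lp_A_eq v = vector [3 * (real v - 3), 3 * real ((v - 3) choose 2), real ((v - 3) choose 3)]"

definition lp_b_eq :: "nat \<Rightarrow> nat \<Rightarrow> (nat \<Rightarrow> nat) \<Rightarrow> real" where
  "lp_b_eq v k m = 1 / real (v choose 3) * (\<Sum>i=1..k. (real (m i))\<^sup>2) - 1"

definition lp_A_neq :: "nat \<Rightarrow> real^3^3" where
  "lp_A_neq v = vector
     [vector [2 * real v - 9, 1/2 * ((real v)\<^sup>2 - 13 * real v + 36), 1/2 * (- (real v)\<^sup>2 + 9 * real v - 20)],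
      vector [real v - 7, - 2 * real v + 11, real v - 5],
      vector [- 3, 3, - 1]]"

definition lp_b_neq :: "real^3" where
  "lp_b_neq = - vector [1, 1, 1]"

text \<open>The order on \<^typ>\<open>real^3\<close> is componentwise; the row \<open>lp_A_eq\<close> acts by the inner product.\<close>

definition lp_feasible :: "nat \<Rightarrow> nat \<Rightarrow> (nat \<Rightarrow> nat) \<Rightarrow> (real^3) set" where
  "lp_feasible v k m =
     {y. lp_A_eq v \<bullet> y = lp_b_eq v k m \<and> lp_b_neq \<le> lp_A_neq v *v y \<and> 0 \<le> y}"

end

theory Submission imports Defs begin

text \<open>
  Let \<open>A\<^sub>0, \<dots>, A\<^sub>3\<close> be the matrices of the Johnson scheme, \<open>A\<^sub>1\<close> being the adjacency matrix.
  Multiplication by \<open>A\<^sub>1\<close> is a three-term recurrence on the span of the \<open>A\<^sub>i\<close>, so for each eigenvalue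
  \<open>\<theta>\<close> of \<open>A\<^sub>1\<close> there is a matrix \<open>E\<close> in the span with \<open>A\<^sub>1 E = \<theta> E\<close>; then every element of the span
  acts on \<open>E\<close> as a scalar, \<open>E\<^sup>2\<close> is a positive multiple of \<open>E\<close>, and \<open>E\<close> is positive semidefinite.
  Averaging a feasible \<open>Y\<close> over each relation gives \<open>y\<close>; since the trace of a product of positive
  semidefinite matrices is nonnegative, \<open>tr(E Y) \<ge> 0\<close>, which is one row of \<open>A\<^sub>n\<^sub>e\<^sub>q y \<ge> b\<^sub>n\<^sub>e\<^sub>q\<close> for each
  nontrivial \<open>\<theta>\<close>. Conversely \<open>A\<^sub>0 + y\<^sub>1 A\<^sub>1 + y\<^sub>2 A\<^sub>2 + y\<^sub>3 A\<^sub>3\<close> is a combination of the four \<open>E\<close>'s whose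
  coefficients are these rows, the trivial one being controlled by \<open>(\<Sum>m\<^sub>i)\<^sup>2 \<le> k \<Sum>m\<^sub>i\<^sup>2\<close>.
\<close>

section \<open>Counting neighbours in Johnson graphs\<close>

lemma johnson_neighbours:
  assumes "finite \<Omega>" and "S \<in> johnson_vertices \<Omega> d" and "0 < d"
  shows "bij_betw (\<lambda>(a, b). insert b (S - {a})) (S \<times> (\<Omega> - S))
           {R \<in> johnson_vertices \<Omega> d. johnson_adj d S R}"
proof -
  have S: "S \<subseteq> \<Omega>" "card S = d" "finite S"
    using assms by (auto simp: johnson_vertices_def intro: finite_subset)
  have "insert b (S - {a}) \<in> {R \<in> johnson_vertices \<Omega> d. johnson_adj d S R}"
    if "a \<in> S" "b \<in> \<Omega> - S" for a b
  proof -
    have "S \<inter> insert b (S - {a}) = S - {a}" using that by auto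
    then show ?thesis
      using that S \<open>0 < d\<close>
      by (auto simp: johnson_vertices_def johnson_adj_def card_insert_if)
  qed
  moreover have "R \<in> (\<lambda>(a, b). insert b (S - {a})) ` (S \<times> (\<Omega> - S))"
    if "R \<in> johnson_vertices \<Omega> d" "johnson_adj d S R" for R
  proof -
    have R: "R \<subseteq> \<Omega>" "card R = d" "finite R"
      using that assms by (auto simp: johnson_vertices_def intro: finite_subset)
    have "card (S - R) = 1" "card (R - S) = 1"
      using that(2) S R \<open>0 < d\<close> card_Int_Diff[of S R] card_Int_Diff[of R S]
      by (auto simp: johnson_adj_def Int_commute)
    then obtain a b where ab: "S - R = {a}" "R - S = {b}"
      by (auto simp: card_1_singleton_iff)
    then have "R = insert b (S - {a})" "a \<in> S" "b \<in> \<Omega> - S" using R by auto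
    then show ?thesis by blast
  qed
  \<comment> \<open>A swap can be read off from its result \<open>R\<close>, since
    \<open>S - R = {a}\<close> and \<open>R - S = {b}\<close>.\<close>
  moreover have "inj_on (\<lambda>(a, b). insert b (S - {a})) (S \<times> (\<Omega> - S))"
  proof (rule inj_onI, clarsimp)
    fix a b a' b'
    assume *: "a \<in> S" "b \<notin> S" "a' \<in> S" "b' \<notin> S" "insert b (S - {a}) = insert b' (S - {a'})"
    then have "S - insert b (S - {a}) = {a}" "S - insert b' (S - {a'}) = {a'}"
      "insert b (S - {a}) - S = {b}" "insert b' (S - {a'}) - S = {b'}" by auto
    then show "a = a' \<and> b = b'" using *(5) by (metis singleton_inject)
  qed
  ultimately show ?thesis by (auto simp: bij_betw_def)
qed

text \<open>The intersection numbers of the Johnson scheme, acting on functions of \<^term>\<open>card (S \<inter> T)\<close>.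
  The truncated \<open>c - 1\<close> at \<open>c = 0\<close> and the value at \<open>d + 1\<close> for \<open>c = d\<close> have coefficient \<open>0\<close>.\<close>

definition johnson_step :: "nat \<Rightarrow> nat \<Rightarrow> (nat \<Rightarrow> real) \<Rightarrow> nat \<Rightarrow> real" where
  "johnson_step v d p c =
     real c * (real v - 2 * real d + real c) * p (c - 1) +
     (real d - real c) * (real v - 2 * real d + 2 * real c) * p c +
     (real d - real c)\<^sup>2 * p (c + 1)"

text \<open>Swapping \<open>a\<close> for \<open>b\<close> lowers the intersection with
  \<open>T\<close> by one if only \<open>a\<close> lies in \<open>T\<close>, raises it by one if
  only \<open>b\<close> does, and keeps it otherwise. The numbers of such pairs are the coefficients
  of \<open>johnson_step\<close>.\<close>

lemma sum_johnson_neighbours: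
  fixes p :: "nat \<Rightarrow> real"
  assumes "finite \<Omega>" and "S \<in> johnson_vertices \<Omega> d" and "T \<in> johnson_vertices \<Omega> d" and "0 < d"
  shows "(\<Sum>R | R \<in> johnson_vertices \<Omega> d \<and> johnson_adj d S R. p (card (R \<inter> T))) =
         johnson_step (card \<Omega>) d p (card (S \<inter> T))"
proof -
  define c where "c = card (S \<inter> T)"
  have S: "S \<subseteq> \<Omega>" "card S = d" "finite S" and T: "T \<subseteq> \<Omega>" "card T = d" "finite T"
    using assms by (auto simp: johnson_vertices_def intro: finite_subset)
  have cS: "real (card (S - T)) = real d - real c" and cT: "real (card (T - S)) = real d - real c"
    using card_Int_Diff[of S T] card_Int_Diff[of T S] S T by (auto simp: c_def Int_commute)
  have cO: "real (card (\<Omega> - S - T)) = real (card \<Omega>) - 2 * real d + real c"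
  proof -
    have "\<Omega> = (\<Omega> - S - T) \<union> (S \<union> T)" using S T by auto
    then have "card \<Omega> = card (\<Omega> - S - T) + card (S \<union> T)"
      using S T assms(1) card_Un_disjoint[of "\<Omega> - S - T" "S \<union> T"] by auto
    moreover have "card (S \<union> T) + c = 2 * d"
      using card_Un_Int[of S T] S T by (simp add: c_def)
    ultimately show ?thesis by linarith
  qed
  have val: "card (insert b (S - {a}) \<inter> T) =
      (if a \<in> T then c - 1 else c) + (if b \<in> T then 1 else 0)" if "a \<in> S" "b \<in> \<Omega> - S" for a b
  proof -
    have "insert b (S - {a}) \<inter> T = (if b \<in> T then insert b (S \<inter> T - {a}) else S \<inter> T - {a})"
      by auto
    moreover have "card (S \<inter> T - {a}) = (if a \<in> T then c - 1 else c)"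
      using that S by (auto simp: c_def)
    ultimately show ?thesis using that S by auto
  qed
  \<comment> \<open>The truncated \<open>c - 1\<close> occurs only for \<open>a\<close> in
    \<open>S \<inter> T\<close>, where \<open>c\<close> is positive.\<close>
  have cpos: "c - 1 + 1 = c" if "a \<in> S \<inter> T" for a
  proof -
    have "0 < card (S \<inter> T)" using that S by (auto simp: card_gt_0_iff)
    then show ?thesis by (simp add: c_def)
  qed
  have "(\<Sum>R | R \<in> johnson_vertices \<Omega> d \<and> johnson_adj d S R. p (card (R \<inter> T))) =
      (\<Sum>(a, b) \<in> S \<times> (\<Omega> - S). p (card (insert b (S - {a}) \<inter> T)))"
    using sum.reindex_bij_betw[OF johnson_neighbours[OF assms(1,2,4)], of "\<lambda>R. p (card (R \<inter> T))"]
    by (simp add: case_prod_unfold)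
  also have "\<dots> = (\<Sum>a\<in>S. \<Sum>b\<in>\<Omega> - S. p (card (insert b (S - {a}) \<inter> T)))"
    by (simp add: sum.cartesian_product)
  also have "\<dots> = (\<Sum>a\<in>S. \<Sum>b\<in>\<Omega> - S.
      p ((if a \<in> T then c - 1 else c) + (if b \<in> T then 1 else 0)))"
    by (intro sum.cong refl) (simp only: val)
  also have "\<dots> = (\<Sum>a\<in>S. (real d - real c) * p ((if a \<in> T then c - 1 else c) + 1) +
      (real (card \<Omega>) - 2 * real d + real c) * p (if a \<in> T then c - 1 else c))"
  proof (intro sum.cong refl)
    fix a
    let ?q = "if a \<in> T then c - 1 else c"
    have "(\<Sum>b\<in>\<Omega> - S. p (?q + (if b \<in> T then 1 else 0))) =
        (\<Sum>b\<in>T - S. p (?q + (if b \<in> T then 1 else 0))) +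
        (\<Sum>b\<in>\<Omega> - S - T. p (?q + (if b \<in> T then 1 else 0)))"
      using T assms(1) by (subst sum.union_disjoint[symmetric]) (auto intro!: sum.cong)
    also have "\<dots> = (\<Sum>b\<in>T - S. p (?q + 1)) + (\<Sum>b\<in>\<Omega> - S - T. p ?q)"
      by (intro arg_cong2[where f="(+)"] sum.cong) auto
    finally show "(\<Sum>b\<in>\<Omega> - S. p (?q + (if b \<in> T then 1 else 0))) =
        (real d - real c) * p (?q + 1) + (real (card \<Omega>) - 2 * real d + real c) * p ?q"
      by (simp only: sum_constant cT cO)
  qed
  also have "\<dots> =
      (\<Sum>a\<in>S \<inter> T. (real d - real c) * p c + (real (card \<Omega>) - 2 * real d + real c) * p (c - 1)) +
      (\<Sum>a\<in>S - T. (real d - real c) * p (c + 1) + (real (card \<Omega>) - 2 * real d + real c) * p c)"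
    unfolding sum.Int_Diff[OF S(3), of _ T]
    using cpos by (intro arg_cong2[where f="(+)"] sum.cong) auto
  also have "\<dots> = johnson_step (card \<Omega>) d p c"
    by (simp only: sum_constant cS c_def[symmetric])
       (simp add: johnson_step_def algebra_simps power2_eq_square)
  finally show ?thesis by (simp add: c_def)
qed

section \<open>The matrices of the Johnson scheme\<close>

locale johnson_labelling =
  fixes \<Omega> :: "'a set" and d :: nat and vertex :: "'n::finite \<Rightarrow> 'a set"
  assumes finite_ground: "finite \<Omega>" and pos_size: "0 < d"
    and bij_vertex: "bij_betw vertex UNIV (johnson_vertices \<Omega> d)"
begin

definition meet :: "'n \<Rightarrow> 'n \<Rightarrow> nat" where
  "meet i j = card (vertex i \<inter> vertex j)"

definition scheme_matrix :: "(nat \<Rightarrow> real) \<Rightarrow> real^'n^'n" where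
  "scheme_matrix p = (\<chi> i j. p (meet i j))"

lemma scheme_matrix_nth [simp]: "scheme_matrix p $ i $ j = p (meet i j)"
  by (simp add: scheme_matrix_def)

lemma vertex_in: "vertex i \<in> johnson_vertices \<Omega> d"
  using bij_vertex by (auto simp: bij_betw_def)

lemma finite_vertex: "finite (vertex i)"
  using vertex_in finite_ground by (auto simp: johnson_vertices_def intro: finite_subset)

lemma card_vertex: "card (vertex i) = d"
  using vertex_in by (auto simp: johnson_vertices_def)

lemma card_labels: "CARD('n) = card \<Omega> choose d"
  using bij_betw_same_card[OF bij_vertex] n_subsets[OF finite_ground, of d]
  by (simp add: johnson_vertices_def)

lemma meet_commute: "meet i j = meet j i"
  by (simp add: meet_def Int_commute)

lemma meet_le: "meet i j \<le> d"
  using card_mono[OF finite_vertex, of "vertex i \<inter> vertex j" i] by (simp add: meet_def card_vertex)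

lemma meet_self [simp]: "meet i i = d"
  by (simp add: meet_def card_vertex)

lemma meet_eq_iff [simp]: "meet i j = d \<longleftrightarrow> i = j"
proof
  assume "meet i j = d"
  then have "vertex i \<inter> vertex j = vertex i" "vertex i \<inter> vertex j = vertex j"
    using card_subset_eq[OF finite_vertex, of "vertex i \<inter> vertex j"]
    by (auto simp: meet_def card_vertex)
  then have "vertex i = vertex j" by simp
  then show "i = j" using bij_vertex by (auto simp: bij_betw_def inj_on_def)
qed simp

lemma symmetric_scheme_matrix: "symmetric_matrix (scheme_matrix p)"
  by (simp add: symmetric_matrix_def transpose_def vec_eq_iff meet_commute)

lemma scheme_matrix_diag: "scheme_matrix (\<lambda>c. of_bool (c = d)) = mat 1"
  by (simp add: vec_eq_iff mat_def)

lemma adjacency_eq_scheme_matrix: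
  "adjacency_matrix (\<lambda>i j. johnson_adj d (vertex i) (vertex j)) =
   scheme_matrix (\<lambda>c. of_bool (c = d - 1))"
  by (simp add: adjacency_matrix_def johnson_adj_def meet_def vec_eq_iff)

text \<open>Entry \<open>(i, j)\<close> of the product sums \<open>p\<close> over the neighbours of
  \<open>vertex i\<close>, so the neighbour count applies after relabelling along the
  bijection.\<close>

lemma adjacency_times_scheme_matrix:
  "scheme_matrix (\<lambda>c. of_bool (c = d - 1)) ** scheme_matrix p =
   scheme_matrix (johnson_step (card \<Omega>) d p)"
proof -
  have "(\<Sum>r\<in>UNIV. of_bool (meet i r = d - 1) * p (meet r j)) =
      johnson_step (card \<Omega>) d p (meet i j)" for i j
  proof -
    have "(\<Sum>r\<in>UNIV. of_bool (meet i r = d - 1) * p (meet r j)) =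
        (\<Sum>R\<in>johnson_vertices \<Omega> d. of_bool (johnson_adj d (vertex i) R) * p (card (R \<inter> vertex j)))"
      unfolding meet_def johnson_adj_def
      by (rule sum.reindex_bij_betw[OF bij_vertex])
    also have "\<dots> = (\<Sum>R | R \<in> johnson_vertices \<Omega> d \<and> johnson_adj d (vertex i) R.
        p (card (R \<inter> vertex j)))"
      using finite_ground
      by (intro sum.mono_neutral_cong_right) (auto simp: johnson_vertices_def)
    also have "\<dots> = johnson_step (card \<Omega>) d p (meet i j)"
      unfolding meet_def
      by (intro sum_johnson_neighbours finite_ground vertex_in pos_size)
    finally show ?thesis .
  qed
  then show ?thesis by (simp add: vec_eq_iff matrix_matrix_mult_def)
qed

end

section \<open>Eigenvalues and characters of J(v,3)\<close>

text \<open>The eigenvalues of \<open>A\<^sub>2\<close> and \<open>A\<^sub>3\<close> on the eigenspace of \<open>A\<^sub>1\<close> for \<open>\<theta>\<close>, with \<open>x = v\<close>, from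
  \<open>A\<^sub>1 A\<^sub>1 = 3(v - 3) A\<^sub>0 + (v - 2) A\<^sub>1 + 4 A\<^sub>2\<close> and \<open>A\<^sub>1 A\<^sub>2 = 2(v - 4) A\<^sub>1 + (2v - 8) A\<^sub>2 + 9 A\<^sub>3\<close>.\<close>

definition eigen2 :: "real \<Rightarrow> real \<Rightarrow> real" where
  "eigen2 x \<theta> = (\<theta>\<^sup>2 - (x - 2) * \<theta> - 3 * (x - 3)) / 4"

definition eigen3 :: "real \<Rightarrow> real \<Rightarrow> real" where
  "eigen3 x \<theta> = ((\<theta> - (2 * x - 8)) * eigen2 x \<theta> - 2 * (x - 4) * \<theta>) / 9"

text \<open>Functions of \<open>c = card (S \<inter> T)\<close> stand for matrices of the scheme: \<open>q c\<close> is the coefficient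
  of \<open>A\<^sub>i\<close> with \<open>i = 3 - c\<close>.\<close>

definition scheme_eigenvalue :: "real \<Rightarrow> real \<Rightarrow> (nat \<Rightarrow> real) \<Rightarrow> real" where
  "scheme_eigenvalue x \<theta> q = q 3 + q 2 * \<theta> + q 1 * eigen2 x \<theta> + q 0 * eigen3 x \<theta>"

text \<open>The divisors are the valencies of \<open>A\<^sub>1\<close>, \<open>A\<^sub>2\<close>,
  \<open>A\<^sub>3\<close>. For an eigenvalue \<theta> this gives the coefficients of
  \<open>E\<close>, scaled to have diagonal 1.\<close>

definition scheme_character :: "real \<Rightarrow> real \<Rightarrow> nat \<Rightarrow> real" where
  "scheme_character x \<theta> c =
     (if c = 3 then 1
      else if c = 2 then \<theta> / (3 * (x - 3))
      else if c = 1 then eigen2 x \<theta> / (3 * (x - 3) * (x - 4) / 2)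
      else eigen3 x \<theta> / ((x - 3) * (x - 4) * (x - 5) / 6))"

text \<open>These are \<open>(3 - j) * (x - 3 - j) - j\<close> for \<open>j = 0, 1, 2, 3\<close>;
  the first is the valency of the graph.\<close>

definition johnson_eigenvalues :: "real \<Rightarrow> real set" where
  "johnson_eigenvalues x = {3 * (x - 3), 2 * x - 9, x - 7, - 3}"

text \<open>The first two values are valencies and become entries of \<open>lp_A_eq\<close>; each
  later pair, preceded by its \<theta>, is a row of \<open>lp_A_neq\<close>.\<close>

lemma eigen_eqs:
  "eigen2 x (3 * (x - 3)) = 3 * (x - 3) * (x - 4) / 2"
  "eigen3 x (3 * (x - 3)) = (x - 3) * (x - 4) * (x - 5) / 6"
  "eigen2 x (2 * x - 9) = (x\<^sup>2 - 13 * x + 36) / 2"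
  "eigen3 x (2 * x - 9) = (- x\<^sup>2 + 9 * x - 20) / 2"
  "eigen2 x (x - 7) = - 2 * x + 11"
  "eigen3 x (x - 7) = x - 5"
  "eigen2 x (- 3) = 3"
  "eigen3 x (- 3) = - 1"
  unfolding eigen3_def eigen2_def by (simp_all add: field_simps power2_eq_square)

lemma le_3_cases: "c \<le> 3 \<Longrightarrow> c = 0 \<or> c = 1 \<or> c = 2 \<or> c = (3::nat)"
  by auto

text \<open>At \<open>c = 3, 2, 1\<close> the identity holds for every \<theta>, by the definitions
  of the character, \<open>eigen2\<close> and \<open>eigen3\<close>. The case \<open>c = 0\<close>
  closes the recurrence: it is a quartic condition on \<theta> whose roots are the four
  eigenvalues.\<close>

lemma johnson_step_character:
  assumes "v \<ge> 6" and "\<theta> \<in> johnson_eigenvalues (real v)" and "c \<le> 3"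
  shows "johnson_step v 3 (scheme_character (real v) \<theta>) c = \<theta> * scheme_character (real v) \<theta> c"
proof -
  define x where "x = real v"
  have x: "x \<ge> 6" using assms by (simp add: x_def)
  have n: "x - 3 \<noteq> 0" "x - 4 \<noteq> 0" "x - 5 \<noteq> 0" using x by auto
  have gen: "c = 1 \<or> c = 2 \<or> c = 3 \<Longrightarrow> ?thesis"
    using n unfolding johnson_step_def scheme_character_def x_def[symmetric] eigen3_def eigen2_def
    by (elim disjE; simp add: divide_simps; simp add: algebra_simps power2_eq_square)
  have "(\<theta> - 3 * (x - 6)) * eigen3 x \<theta> = (x - 5) * eigen2 x \<theta>"
    using assms(2) unfolding johnson_eigenvalues_def x_def[symmetric]
    by (elim insertE emptyE; simp only: eigen_eqs;
        simp add: divide_simps; simp add: algebra_simps power2_eq_square)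
  then have e2: "eigen2 x \<theta> = (\<theta> - 3 * (x - 6)) * eigen3 x \<theta> / (x - 5)"
    using n by (simp add: field_simps)
  have zero: "c = 0 \<Longrightarrow> ?thesis"
    unfolding johnson_step_def scheme_character_def x_def[symmetric] e2
    using n by (simp add: divide_simps; simp add: algebra_simps power2_eq_square)
  show ?thesis using gen zero le_3_cases[OF assms(3)] by blast
qed

lemma scheme_character_trivial:
  assumes "v \<ge> 6" and "\<theta> = 3 * (real v - 3)"
  shows "scheme_character (real v) \<theta> c = 1"
  using assms(1) unfolding scheme_character_def assms(2) eigen_eqs by simp

text \<open>The dual orthogonality relations of \<open>J(v,3)\<close>; the coefficients are the multiplicities
  \<open>1, v - 1, (v choose 2) - v, (v choose 3) - (v choose 2)\<close> of the eigenvalues.\<close>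

lemma scheme_inversion:
  fixes q :: "nat \<Rightarrow> real"
  assumes "x \<ge> 6" and "c \<le> 3"
  shows "x * (x - 1) * (x - 2) / 6 * q c =
    scheme_eigenvalue x (3 * (x - 3)) q * scheme_character x (3 * (x - 3)) c +
    (x - 1) * (scheme_eigenvalue x (2 * x - 9) q * scheme_character x (2 * x - 9) c) +
    x * (x - 3) / 2 * (scheme_eigenvalue x (x - 7) q * scheme_character x (x - 7) c) +
    x * (x - 1) * (x - 5) / 6 * (scheme_eigenvalue x (- 3) q * scheme_character x (- 3) c)"
proof -
  define e where "e = (\<lambda>\<theta> b. if b = (3::nat) then 1 else if b = 2 then \<theta>
    else if b = 1 then eigen2 x \<theta> else eigen3 x \<theta>)"
  define val where "val = (\<lambda>b. if b = 3 then 1 else if b = 2 then 3 * (x - 3)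
    else if b = (1::nat) then 3 * (x - 3) * (x - 4) / 2 else (x - 3) * (x - 4) * (x - 5) / 6)"
  have pos: "val c \<noteq> 0" using assms(1) by (simp add: val_def)
  have char: "scheme_character x \<theta> c = e \<theta> c / val c" for \<theta>
    by (simp add: scheme_character_def e_def val_def)
  have eig: "scheme_eigenvalue x \<theta> q = (\<Sum>b\<in>{0,1,2,3}. q b * e \<theta> b)" for \<theta>
    by (simp add: scheme_eigenvalue_def e_def)
  \<comment> \<open>By linearity in \<open>q\<close> it suffices to treat the indicator of a single
    \<open>b\<close>; scaled by the valency \<open>val c\<close>, the claim becomes finitely many
    polynomial identities.\<close>
  have orth: "e (3 * (x - 3)) b * e (3 * (x - 3)) c +
      (x - 1) * (e (2 * x - 9) b * e (2 * x - 9) c) +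
      x * (x - 3) / 2 * (e (x - 7) b * e (x - 7) c) +
      x * (x - 1) * (x - 5) / 6 * (e (- 3) b * e (- 3) c) =
      (if b = c then x * (x - 1) * (x - 2) / 6 * val c else 0)" if "b \<in> {0,1,2,3}" for b
    using that le_3_cases[OF assms(2)] unfolding e_def val_def eigen_eqs
    by (elim insertE emptyE disjE; simp; simp add: field_simps power2_eq_square)
  have "(\<Sum>b\<in>{0,1,2,3}. q b * e (3 * (x - 3)) b) * e (3 * (x - 3)) c +
      (x - 1) * ((\<Sum>b\<in>{0,1,2,3}. q b * e (2 * x - 9) b) * e (2 * x - 9) c) +
      x * (x - 3) / 2 * ((\<Sum>b\<in>{0,1,2,3}. q b * e (x - 7) b) * e (x - 7) c) +
      x * (x - 1) * (x - 5) / 6 * ((\<Sum>b\<in>{0,1,2,3}. q b * e (- 3) b) * e (- 3) c) =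
      (\<Sum>b\<in>{0,1,2,3}. q b * (e (3 * (x - 3)) b * e (3 * (x - 3)) c +
      (x - 1) * (e (2 * x - 9) b * e (2 * x - 9) c) +
      x * (x - 3) / 2 * (e (x - 7) b * e (x - 7) c) +
      x * (x - 1) * (x - 5) / 6 * (e (- 3) b * e (- 3) c)))"
    by (simp only: sum_distrib_left sum_distrib_right sum.distrib distrib_left mult_ac)
  also have "\<dots> = (\<Sum>b\<in>{0,1,2,3}. q b * (if b = c then x * (x - 1) * (x - 2) / 6 * val c else 0))"
    by (intro sum.cong refl) (simp only: orth)
  also have "\<dots> = x * (x - 1) * (x - 2) / 6 * q c * val c"
    using le_3_cases[OF assms(2)] by auto
  finally show ?thesis
    unfolding char eig times_divide_eq_right add_divide_distrib[symmetric]
    using pos by simp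
qed

section \<open>The linear program in terms of eigenvalues\<close>

lemma real_choose_three: "real (n choose 3) = real n * (real n - 1) * (real n - 2) / 6"
  by (simp add: binomial_gbinomial gbinomial_prod_rev numeral_3_eq_3 lessThan_Suc mult_ac)

lemma real_choose_two: "real (n choose 2) = real n * (real n - 1) / 2"
  by (simp add: binomial_gbinomial gbinomial_prod_rev numeral_2_eq_2 lessThan_Suc mult_ac)

definition lp_profile :: "real^3 \<Rightarrow> nat \<Rightarrow> real" where
  "lp_profile y c = (if c = 3 then 1 else if c = 2 then y $ 1 else if c = 1 then y $ 2 else y $ 3)"

text \<open>The profile has value 1 at \<open>c = 3\<close>, which adds 1 to each eigenvalue and so
  cancels the -1 in \<open>lp_b_eq\<close> and \<open>lp_b_neq\<close>.\<close>

lemma lp_feasible_iff: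
  assumes "v \<ge> 6"
  shows "y \<in> lp_feasible v k m \<longleftrightarrow>
    scheme_eigenvalue (real v) (3 * (real v - 3)) (lp_profile y) =
      (\<Sum>i=1..k. (real (m i))\<^sup>2) / real (v choose 3) \<and>
    (\<forall>\<theta>\<in>johnson_eigenvalues (real v) - {3 * (real v - 3)}.
      0 \<le> scheme_eigenvalue (real v) \<theta> (lp_profile y)) \<and>
    0 \<le> y"
proof -
  define x where "x = real v"
  have x: "x \<ge> 6" using assms by (simp add: x_def)
  have sub: "real (v - 3) = x - 3" using assms by (simp add: x_def of_nat_diff)
  have "johnson_eigenvalues x - {3 * (x - 3)} = {2 * x - 9, x - 7, - 3}"
    using x by (auto simp: johnson_eigenvalues_def)
  note others = this
  let ?e = "\<lambda>\<theta>. scheme_eigenvalue x \<theta> (lp_profile y)"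
  have "lp_A_eq v \<bullet> y = ?e (3 * (x - 3)) - 1"
    unfolding lp_A_eq_def scheme_eigenvalue_def eigen_eqs
      real_choose_two[of "v - 3"] real_choose_three[of "v - 3"] sub x_def[symmetric]
    by (simp add: lp_profile_def inner_vec_def sum_3 field_simps)
  then have eq: "lp_A_eq v \<bullet> y = lp_b_eq v k m \<longleftrightarrow>
      ?e (3 * (x - 3)) = (\<Sum>i=1..k. (real (m i))\<^sup>2) / real (v choose 3)"
    by (simp add: lp_b_eq_def)
  have "(lp_A_neq v *v y) $ 1 = ?e (2 * x - 9) - 1" "(lp_A_neq v *v y) $ 2 = ?e (x - 7) - 1"
      "(lp_A_neq v *v y) $ 3 = ?e (- 3) - 1"
    unfolding lp_A_neq_def scheme_eigenvalue_def eigen_eqs x_def[symmetric]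
    by (simp_all add: lp_profile_def matrix_vector_mult_def sum_3 field_simps)
  then have neq: "lp_b_neq \<le> lp_A_neq v *v y \<longleftrightarrow>
      0 \<le> ?e (2 * x - 9) \<and> 0 \<le> ?e (x - 7) \<and> 0 \<le> ?e (- 3)"
    by (simp add: less_eq_vec_def forall_3 lp_b_neq_def)
  show ?thesis
    unfolding x_def[symmetric] others lp_feasible_def mem_Collect_eq eq neq by simp
qed

section \<open>Passing between the semidefinite and the linear program\<close>

lemma quadratic_form: "u \<bullet> (Y *v u) = (\<Sum>i\<in>UNIV. \<Sum>j\<in>UNIV. u $ i * u $ j * Y $ i $ j)"
  for Y :: "real^'n^'n"
  by (simp add: inner_vec_def matrix_vector_mult_def sum_distrib_left mult_ac)

locale johnson3_labelling = johnson_labelling \<Omega> 3 vertex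
  for \<Omega> :: "'a set" and vertex :: "'n::finite \<Rightarrow> 'a set" +
  assumes large: "card \<Omega> \<ge> 6"
begin

abbreviation "x \<equiv> real (card \<Omega>)"

lemma meet_cases: "meet i j = 0 \<or> meet i j = 1 \<or> meet i j = 2 \<or> meet i j = 3"
  using le_3_cases[OF meet_le] .

text \<open>The adjacency matrix \<open>?K 2\<close> acts as \<theta>. Solving the two product
  formulas for \<open>A\<^sub>2\<close> and \<open>A\<^sub>3\<close> writes them as polynomials in
  it, and linearity in \<open>q\<close> does the rest.\<close>

lemma scheme_matrix_times_character:
  assumes "\<theta> \<in> johnson_eigenvalues x"
  shows "scheme_matrix q ** scheme_matrix (scheme_character x \<theta>) =
         scheme_eigenvalue x \<theta> q *\<^sub>R scheme_matrix (scheme_character x \<theta>)"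
proof -
  let ?K = "\<lambda>c. scheme_matrix (\<lambda>b. of_bool (b = c))"
  let ?P = "scheme_matrix (scheme_character x \<theta>)"
  have mult1: "?K 2 ** scheme_matrix p = scheme_matrix (johnson_step (card \<Omega>) 3 p)" for p
    using adjacency_times_scheme_matrix[of p] by simp
  have sub: "(A - B) ** ?P = A ** ?P - B ** ?P" for A B :: "real^'n^'n"
    by (simp add: matrix_matrix_mult_def vec_eq_iff left_diff_distrib sum_subtractf)
  have add: "(A + B) ** ?P = A ** ?P + B ** ?P" for A B :: "real^'n^'n"
    by (simp add: matrix_matrix_mult_def vec_eq_iff distrib_right sum.distrib)
  have P1: "?K 2 ** ?P = \<theta> *\<^sub>R ?P"
    unfolding mult1 using johnson_step_character[OF large assms] meet_le
    by (simp add: vec_eq_iff)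
  have P0: "?K 3 ** ?P = ?P"
    by (simp add: scheme_matrix_diag)
  have "?K 1 = (1/4) *\<^sub>R (?K 2 ** ?K 2 - (x - 2) *\<^sub>R ?K 2 - (3 * (x - 3)) *\<^sub>R ?K 3)"
    unfolding mult1 vec_eq_iff
  proof (intro allI)
    fix i j
    show "?K 1 $ i $ j = ((1/4) *\<^sub>R (scheme_matrix (johnson_step (card \<Omega>) 3 (\<lambda>b. of_bool (b = 2)))
        - (x - 2) *\<^sub>R ?K 2 - (3 * (x - 3)) *\<^sub>R ?K 3)) $ i $ j"
      using meet_cases[of i j] by (elim disjE; simp add: johnson_step_def algebra_simps del: meet_eq_iff)
  qed
  then have P2: "?K 1 ** ?P = eigen2 x \<theta> *\<^sub>R ?P"
    by (simp only: sub scalar_matrix_assoc[symmetric] matrix_mul_assoc[symmetric] matrix_scalar_ac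
        P1 P0) (simp add: vec_eq_iff eigen2_def field_simps power2_eq_square)
  have "?K 0 = (1/9) *\<^sub>R (?K 2 ** ?K 1 - (2 * x - 8) *\<^sub>R ?K 1 - (2 * (x - 4)) *\<^sub>R ?K 2)"
    unfolding mult1 vec_eq_iff
  proof (intro allI)
    fix i j
    show "?K 0 $ i $ j = ((1/9) *\<^sub>R (scheme_matrix (johnson_step (card \<Omega>) 3 (\<lambda>b. of_bool (b = 1)))
        - (2 * x - 8) *\<^sub>R ?K 1 - (2 * (x - 4)) *\<^sub>R ?K 2)) $ i $ j"
      using meet_cases[of i j] by (elim disjE; simp add: johnson_step_def algebra_simps del: meet_eq_iff)
  qed
  then have P3: "?K 0 ** ?P = eigen3 x \<theta> *\<^sub>R ?P"
    by (simp only: sub scalar_matrix_assoc[symmetric] matrix_mul_assoc[symmetric] matrix_scalar_ac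
        P1 P2) (simp add: vec_eq_iff eigen3_def field_simps)
  have "scheme_matrix q = q 3 *\<^sub>R ?K 3 + q 2 *\<^sub>R ?K 2 + q 1 *\<^sub>R ?K 1 + q 0 *\<^sub>R ?K 0"
    unfolding vec_eq_iff
  proof (intro allI)
    fix i j
    show "scheme_matrix q $ i $ j =
        (q 3 *\<^sub>R ?K 3 + q 2 *\<^sub>R ?K 2 + q 1 *\<^sub>R ?K 1 + q 0 *\<^sub>R ?K 0) $ i $ j"
      using meet_cases[of i j] by (elim disjE; simp del: meet_eq_iff)
  qed
  then show ?thesis
    by (simp only: add scalar_matrix_assoc[symmetric] P0 P1 P2 P3 scheme_eigenvalue_def)
       (simp add: algebra_simps)
qed


text \<open>The character matrix \<open>P\<close> is symmetric with
  \<open>P ** P = l *\<^sub>R P\<close> and \<open>l > 0\<close>, so \<open>l\<close> times the sum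
  is the trace of \<open>P Y P\<close>, a sum of quadratic forms of \<open>Y\<close> at the rows of
  \<open>P\<close>.\<close>

lemma sum_character_nonneg:
  assumes "\<theta> \<in> johnson_eigenvalues x" and psd: "\<And>u. 0 \<le> u \<bullet> (Y *v u)"
  shows "0 \<le> (\<Sum>i\<in>UNIV. \<Sum>j\<in>UNIV. scheme_character x \<theta> (meet i j) * Y $ i $ j)"
proof -
  define p where "p = scheme_character x \<theta>"
  define l where "l = scheme_eigenvalue x \<theta> p"
  have pp: "(\<Sum>r\<in>UNIV. p (meet i r) * p (meet r j)) = l * p (meet i j)" for i j
    using scheme_matrix_times_character[OF assms(1), of p]
    by (simp add: vec_eq_iff matrix_matrix_mult_def l_def p_def)
  have p3: "p 3 = 1" by (simp add: p_def scheme_character_def)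
  \<comment> \<open>A diagonal entry of \<open>P ** P\<close> equals \<open>l\<close>, and it is a
    sum of squares containing the square of a diagonal 1.\<close>
  have "0 < l"
  proof -
    fix i
    have "0 < p (meet i i) * p (meet i i)" by (simp add: p3)
    also have "\<dots> \<le> (\<Sum>r\<in>UNIV. p (meet i r) * p (meet r i))"
      by (rule member_le_sum) (auto simp: meet_commute)
    finally show ?thesis using pp[of i i] p3 by simp
  qed
  have "l * (\<Sum>i\<in>UNIV. \<Sum>j\<in>UNIV. p (meet i j) * Y $ i $ j) =
      (\<Sum>i\<in>UNIV. \<Sum>j\<in>UNIV. \<Sum>r\<in>UNIV. p (meet i r) * p (meet r j) * Y $ i $ j)"
    by (simp add: sum_distrib_left mult.assoc[symmetric] pp[symmetric] sum_distrib_right)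
  also have "\<dots> = (\<Sum>i\<in>UNIV. \<Sum>r\<in>UNIV. \<Sum>j\<in>UNIV. p (meet i r) * p (meet r j) * Y $ i $ j)"
    by (intro sum.cong refl sum.swap)
  also have "\<dots> = (\<Sum>r\<in>UNIV. \<Sum>i\<in>UNIV. \<Sum>j\<in>UNIV. p (meet i r) * p (meet r j) * Y $ i $ j)"
    by (rule sum.swap)
  also have "\<dots> = (\<Sum>r\<in>UNIV. (\<chi> i. p (meet r i)) \<bullet> (Y *v (\<chi> i. p (meet r i))))"
    by (simp add: quadratic_form meet_commute)
  also have "0 \<le> \<dots>" by (intro sum_nonneg psd)
  finally show ?thesis using \<open>0 < l\<close> by (simp add: p_def zero_le_mult_iff)
qed

text \<open>The character of the trivial eigenvalue is constantly 1, so its matrix is all-ones and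
  multiplying by it yields row sums.\<close>

lemma row_sum_scheme: "(\<Sum>j\<in>UNIV. q (meet i j)) = scheme_eigenvalue x (3 * (x - 3)) q"
proof -
  define \<theta> where "\<theta> = 3 * (x - 3)"
  have "\<theta> \<in> johnson_eigenvalues x" by (simp add: johnson_eigenvalues_def \<theta>_def)
  from scheme_matrix_times_character[OF this, of q] show ?thesis
    unfolding \<theta>_def[symmetric]
    by (simp add: vec_eq_iff matrix_matrix_mult_def scheme_character_trivial[OF large \<theta>_def])
qed

text \<open>Positive semidefiniteness of the character matrix, from the previous inequality with
  \<open>Y\<close> the rank-one matrix of \<open>u\<close>.\<close>

lemma quadratic_form_character_nonneg:
  assumes "\<theta> \<in> johnson_eigenvalues x"
  shows "0 \<le> (\<Sum>i\<in>UNIV. \<Sum>j\<in>UNIV. scheme_character x \<theta> (meet i j) * (u $ i * u $ j))"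
proof -
  have "0 \<le> w \<bullet> ((\<chi> i j. u $ i * u $ j) *v w)" for w
  proof -
    have "w \<bullet> ((\<chi> i j. u $ i * u $ j) *v w) = (\<Sum>i\<in>UNIV. w $ i * u $ i)\<^sup>2"
      by (simp add: quadratic_form power2_eq_square sum_product mult_ac)
    then show ?thesis by simp
  qed
  from sum_character_nonneg[OF assms this] show ?thesis by simp
qed

lemma real_card_labels: "real CARD('n) = x * (x - 1) * (x - 2) / 6"
  by (simp add: card_labels real_choose_three)

lemma gpp_objective_eq:
  assumes "symmetric_matrix Y"
  shows "gpp_objective (scheme_matrix (\<lambda>c. of_bool (c = 2))) Y =
    1/2 * (real CARD('n) * (3 * (x - 3)) -
           (\<Sum>i\<in>UNIV. \<Sum>j\<in>UNIV. of_bool (meet i j = 2) * Y $ i $ j))"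
proof -
  have "Y $ i $ j = Y $ j $ i" for i j
    using assms by (auto simp: symmetric_matrix_def transpose_def vec_eq_iff)
  then have "gpp_objective (scheme_matrix (\<lambda>c. of_bool (c = 2))) Y =
    1/2 * (\<Sum>i\<in>UNIV. (\<Sum>j\<in>UNIV. of_bool (meet i j = 2)) -
           (\<Sum>j\<in>UNIV. of_bool (meet i j = 2) * Y $ i $ j))"
    by (simp add: gpp_objective_def trace_def matrix_matrix_mult_def all_ones_matrix_def
        right_diff_distrib sum_subtractf del: sum_of_bool_eq)
  then show ?thesis
    using row_sum_scheme[of "\<lambda>c. of_bool (c = 2)"]
    by (simp add: sum_subtractf scheme_eigenvalue_def del: sum_of_bool_eq)
qed

lemma trace_all_ones: "trace (all_ones_matrix ** Y) = (\<Sum>i\<in>UNIV. \<Sum>j\<in>UNIV. Y $ i $ j)"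
  for Y :: "real^'n^'n"
  unfolding trace_def matrix_matrix_mult_def all_ones_matrix_def by simp (rule sum.swap)

lemma sum_split_meet:
  "(\<Sum>i\<in>UNIV. \<Sum>j\<in>UNIV. q (meet i j) * Y $ i $ j) =
    (\<Sum>c\<in>{0,1,2,3}. q c * (\<Sum>i\<in>UNIV. \<Sum>j\<in>UNIV. of_bool (meet i j = c) * Y $ i $ j))"
  for Y :: "real^'n^'n"
proof -
  have "q (meet i j) * Y $ i $ j = (\<Sum>c\<in>{0,1,2,3}. q c * (of_bool (meet i j = c) * Y $ i $ j))"
    for i j
    using meet_cases[of i j] by (elim disjE) (simp_all del: meet_eq_iff)
  then have "(\<Sum>i\<in>UNIV. \<Sum>j\<in>UNIV. q (meet i j) * Y $ i $ j) =
      (\<Sum>i\<in>UNIV. \<Sum>j\<in>UNIV. \<Sum>c\<in>{0,1,2,3}. q c * (of_bool (meet i j = c) * Y $ i $ j))"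
    by (simp only:)
  also have "\<dots> = (\<Sum>i\<in>UNIV. \<Sum>c\<in>{0,1,2,3}. \<Sum>j\<in>UNIV. q c * (of_bool (meet i j = c) * Y $ i $ j))"
    by (intro sum.cong refl sum.swap)
  also have "\<dots> = (\<Sum>c\<in>{0,1,2,3}. \<Sum>i\<in>UNIV. \<Sum>j\<in>UNIV. q c * (of_bool (meet i j = c) * Y $ i $ j))"
    by (rule sum.swap)
  finally show ?thesis by (simp only: sum_distrib_left)
qed

lemma all_ones_dot: "u \<bullet> (all_ones_matrix *v u) = (\<Sum>i\<in>UNIV. \<Sum>j\<in>UNIV. u $ i * u $ j)"
  for u :: "real^'n"
  by (simp add: quadratic_form all_ones_matrix_def)

lemma lp_point_gives_gpp_point:
  assumes total: "(\<Sum>i=1..k. m i) = card \<Omega> choose 3"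
    and y: "y \<in> lp_feasible (card \<Omega>) k m"
  shows "scheme_matrix (lp_profile y) \<in> gpp_feasible k m"
proof -
  define n where "n = real CARD('n)"
  define q where "q = lp_profile y"
  have x: "x \<ge> 6" using large by simp
  have n: "n > 0" "n = x * (x - 1) * (x - 2) / 6" "real (card \<Omega> choose 3) = n"
    by (simp add: n_def, simp add: n_def real_card_labels, simp add: n_def card_labels)
  have lp: "scheme_eigenvalue x (3 * (x - 3)) q = (\<Sum>i=1..k. (real (m i))\<^sup>2) / n"
    "\<And>\<theta>. \<theta> \<in> johnson_eigenvalues x - {3 * (x - 3)} \<Longrightarrow> 0 \<le> scheme_eigenvalue x \<theta> q"
    "0 \<le> y"
    using y unfolding lp_feasible_iff[OF large] q_def n(3) by auto
  have q: "q 3 = 1" "0 \<le> q c" for c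
    using lp(3) by (auto simp: q_def lp_profile_def less_eq_vec_def)
  have evs: "2 * x - 9 \<in> johnson_eigenvalues x - {3 * (x - 3)}"
      "x - 7 \<in> johnson_eigenvalues x - {3 * (x - 3)}" "- 3 \<in> johnson_eigenvalues x - {3 * (x - 3)}"
    using x by (auto simp: johnson_eigenvalues_def)
  \<comment> \<open>Cauchy-Schwarz on the part sizes. It makes the trivial component of
    \<open>k Y\<close> large enough to absorb the all-ones matrix.\<close>
  have cauchy: "n \<le> real k * scheme_eigenvalue x (3 * (x - 3)) q"
  proof -
    have "n\<^sup>2 = (\<Sum>i=1..k. real (m i))\<^sup>2" using total n(3) by (simp flip: of_nat_sum)
    also have "\<dots> \<le> (\<Sum>i=1..k. (real (m i))\<^sup>2) * real k"
      using sum_squared_le_sum_of_squares[of "\<lambda>i. real (m i)" "{1..k}"] by simp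
    finally show ?thesis
      unfolding lp(1) using n(1) by (simp add: pos_le_divide_eq power2_eq_square mult.commute)
  qed
  have psd: "0 \<le> u \<bullet> ((real k *\<^sub>R scheme_matrix q - all_ones_matrix) *v u)" for u
  proof -
    define Q where "Q = (\<lambda>\<theta>. \<Sum>i\<in>UNIV. \<Sum>j\<in>UNIV. scheme_character x \<theta> (meet i j) * (u $ i * u $ j))"
    define s where "s = (\<Sum>i\<in>UNIV. \<Sum>j\<in>UNIV. u $ i * u $ j)"
    let ?t = "\<lambda>\<theta>. scheme_eigenvalue x \<theta> q * Q \<theta>"
    have Qnn: "0 \<le> Q \<theta>" if "\<theta> \<in> johnson_eigenvalues x" for \<theta>
      unfolding Q_def by (rule quadratic_form_character_nonneg[OF that])
    have Q0: "Q (3 * (x - 3)) = s"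
      unfolding Q_def s_def scheme_character_trivial[OF large refl] by simp
    have s: "0 \<le> s"
      using Qnn[of "3 * (x - 3)"] unfolding Q0 by (simp add: johnson_eigenvalues_def)
    have "(\<Sum>i\<in>UNIV. \<Sum>j\<in>UNIV. n * q (meet i j) * (u $ i * u $ j)) =
        ?t (3 * (x - 3)) + (x - 1) * ?t (2 * x - 9) + x * (x - 3) / 2 * ?t (x - 7) +
        x * (x - 1) * (x - 5) / 6 * ?t (- 3)"
      unfolding n(2) scheme_inversion[OF x meet_le] Q_def
      by (simp only: sum.distrib distrib_right sum_distrib_left mult.assoc)
    moreover have "0 \<le> (x - 1) * ?t (2 * x - 9)" "0 \<le> x * (x - 3) / 2 * ?t (x - 7)"
        "0 \<le> x * (x - 1) * (x - 5) / 6 * ?t (- 3)"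
      using evs x by (auto intro!: mult_nonneg_nonneg lp(2) Qnn)
    \<comment> \<open>Only the trivial term of the inversion formula is kept; its form
      \<open>s\<close> is that of the all-ones matrix.\<close>
    ultimately have "scheme_eigenvalue x (3 * (x - 3)) q * s \<le>
        (\<Sum>i\<in>UNIV. \<Sum>j\<in>UNIV. n * q (meet i j) * (u $ i * u $ j))"
      unfolding Q0 by linarith
    also have "\<dots> = n * (u \<bullet> (scheme_matrix q *v u))"
      by (simp add: quadratic_form sum_distrib_left mult_ac)
    finally have *: "scheme_eigenvalue x (3 * (x - 3)) q * s \<le> n * (u \<bullet> (scheme_matrix q *v u))" .
    have "n * s \<le> real k * scheme_eigenvalue x (3 * (x - 3)) q * s"
      by (rule mult_right_mono[OF cauchy s])
    also have "\<dots> \<le> real k * (n * (u \<bullet> (scheme_matrix q *v u)))"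
      using mult_left_mono[OF *, of "real k"] by (simp add: mult.assoc)
    finally have "s \<le> real k * (u \<bullet> (scheme_matrix q *v u))"
      using n(1) by (simp add: mult.left_commute)
    then show ?thesis
      by (simp add: matrix_vector_mult_diff_rdistrib inner_diff_right all_ones_dot s_def
          scaleR_matrix_vector_assoc[symmetric])
  qed
  have "symmetric_matrix (real k *\<^sub>R scheme_matrix q - all_ones_matrix)"
    by (simp add: symmetric_matrix_def transpose_def vec_eq_iff meet_commute all_ones_matrix_def)
  moreover have "trace (all_ones_matrix ** scheme_matrix q) = (\<Sum>i=1..k. (real (m i))\<^sup>2)"
    using n(1) by (simp only: trace_all_ones scheme_matrix_nth row_sum_scheme lp(1)) (simp add: n_def)
  ultimately have "scheme_matrix q \<in> gpp_feasible k m"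
    using psd q
    by (simp add: gpp_feasible_def positive_semidefinite_def symmetric_scheme_matrix)
  then show ?thesis by (simp add: q_def)
qed

lemma gpp_objective_lp_profile:
  "gpp_objective (scheme_matrix (\<lambda>c. of_bool (c = 2))) (scheme_matrix (lp_profile y)) =
   lp_objective (card \<Omega>) y"
proof -
  have "(\<Sum>i\<in>UNIV. \<Sum>j\<in>UNIV. of_bool (meet i j = 2) * scheme_matrix (lp_profile y) $ i $ j) =
      (\<Sum>i\<in>UNIV. \<Sum>j\<in>UNIV. (\<lambda>c. of_bool (c = 2) * y $ 1) (meet i j))"
    by (intro sum.cong refl) (simp add: lp_profile_def)
  also have "\<dots> = real CARD('n) * (3 * (x - 3) * y $ 1)"
    by (simp only: row_sum_scheme[of "\<lambda>c. of_bool (c = 2) * y $ 1"])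
       (simp add: scheme_eigenvalue_def)
  finally show ?thesis
    unfolding gpp_objective_eq[OF symmetric_scheme_matrix] lp_objective_def card_labels
    by (simp add: algebra_simps)
qed

lemma gpp_point_gives_lp_point:
  assumes "k > 0" and Y: "Y \<in> gpp_feasible k m"
  shows "\<exists>y\<in>lp_feasible (card \<Omega>) k m.
    lp_objective (card \<Omega>) y = gpp_objective (scheme_matrix (\<lambda>c. of_bool (c = 2))) Y"
proof -
  define n where "n = real CARD('n)"
  define s where "s = (\<lambda>c. \<Sum>i\<in>UNIV. \<Sum>j\<in>UNIV. of_bool (meet i j = c) * Y $ i $ j)"
  \<comment> \<open>Each denominator is \<open>n\<close> times a valency, the number of ordered
    pairs in the relation, so \<open>y\<close> holds the averages of \<open>Y\<close>.\<close>
  define y :: "real^3" where "y = vector [s 2 / (n * (3 * (x - 3))),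
    s 1 / (n * (3 * (x - 3) * (x - 4) / 2)), s 0 / (n * ((x - 3) * (x - 4) * (x - 5) / 6))]"
  have fold_s: "(\<Sum>i\<in>UNIV. \<Sum>j\<in>UNIV. of_bool (meet i j = c) * Y $ i $ j) = s c" for c
    by (simp only: s_def)
  have x: "x \<ge> 6" using large by simp
  have n: "n > 0" "real (card \<Omega> choose 3) = n"
    by (simp add: n_def, simp add: n_def card_labels)
  have feas: "symmetric_matrix Y" "\<And>i. Y $ i $ i = 1" "\<And>i j. 0 \<le> Y $ i $ j"
    "(\<Sum>i\<in>UNIV. \<Sum>j\<in>UNIV. Y $ i $ j) = (\<Sum>i=1..k. (real (m i))\<^sup>2)"
    "\<And>u. 0 \<le> u \<bullet> ((real k *\<^sub>R Y - all_ones_matrix) *v u)"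
    using Y by (auto simp: gpp_feasible_def positive_semidefinite_def trace_all_ones)
  \<comment> \<open>\<open>k Y\<close> is the sum of \<open>k Y - J\<close> and \<open>J\<close>,
    both positive semidefinite.\<close>
  have psd: "0 \<le> u \<bullet> (Y *v u)" for u
  proof -
    have "(\<Sum>i\<in>UNIV. \<Sum>j\<in>UNIV. u $ i * u $ j) = (\<Sum>i\<in>UNIV. u $ i)\<^sup>2"
      by (simp add: power2_eq_square sum_product)
    then have "0 \<le> real k * (u \<bullet> (Y *v u)) - (\<Sum>i\<in>UNIV. u $ i)\<^sup>2"
      using feas(5)[of u]
      by (simp add: matrix_vector_mult_diff_rdistrib inner_diff_right all_ones_dot
          scaleR_matrix_vector_assoc[symmetric])
    then have "0 \<le> real k * (u \<bullet> (Y *v u))"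
      using zero_le_power2[of "\<Sum>i\<in>UNIV. u $ i"] by linarith
    then show ?thesis using \<open>k > 0\<close> by (simp add: zero_le_mult_iff)
  qed
  have s3: "s 3 = n"
    by (simp add: s_def n_def feas(2))
  \<comment> \<open>Averaging preserves the pairing with a character matrix, because the latter is
    constant on each relation.\<close>
  have ev: "n * scheme_eigenvalue x \<theta> (lp_profile y) =
      (\<Sum>i\<in>UNIV. \<Sum>j\<in>UNIV. scheme_character x \<theta> (meet i j) * Y $ i $ j)" for \<theta>
    unfolding sum_split_meet fold_s
    using n(1) x s3
    by (simp add: scheme_eigenvalue_def lp_profile_def y_def scheme_character_def
        distrib_left mult_ac)
  have "n * scheme_eigenvalue x (3 * (x - 3)) (lp_profile y) = (\<Sum>i=1..k. (real (m i))\<^sup>2)"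
    unfolding ev scheme_character_trivial[OF large refl] by (simp add: feas(4))
  then have "scheme_eigenvalue x (3 * (x - 3)) (lp_profile y) = (\<Sum>i=1..k. (real (m i))\<^sup>2) / n"
    using n(1) by (simp only: nonzero_eq_divide_eq) (simp add: mult.commute)
  moreover have "0 \<le> scheme_eigenvalue x \<theta> (lp_profile y)" if "\<theta> \<in> johnson_eigenvalues x" for \<theta>
    using sum_character_nonneg[OF that psd] n(1) by (simp add: ev[symmetric] zero_le_mult_iff)
  moreover have "0 \<le> s c" for c
    by (auto simp: s_def intro!: sum_nonneg feas(3))
  then have "0 \<le> y"
    using x n(1) by (simp add: y_def less_eq_vec_def forall_3)
  ultimately have "y \<in> lp_feasible (card \<Omega>) k m"
    unfolding lp_feasible_iff[OF large] n(2) by blast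
  moreover have "lp_objective (card \<Omega>) y =
      gpp_objective (scheme_matrix (\<lambda>c. of_bool (c = 2))) Y"
    unfolding gpp_objective_eq[OF feas(1)] lp_objective_def n(2) n_def[symmetric] fold_s
    using n(1) x by (simp add: y_def field_simps)
  ultimately show ?thesis by blast
qed

end

section \<open>Attainment of the linear minimum\<close>

lemma lp_feasible_nonempty:
  assumes "v \<ge> 6" and "\<And>i. i \<in> {1..k} \<Longrightarrow> m i > 0" and total: "(\<Sum>i=1..k. m i) = v choose 3"
  shows "lp_feasible v k m \<noteq> {}"
proof -
  define x where "x = real v"
  define n where "n = real (v choose 3)"
  define S where "S = (\<Sum>i=1..k. (real (m i))\<^sup>2)"
  \<comment> \<open>Chosen so that the entries of \<open>(1 - t) I + t J\<close> sum to
    \<open>n + t * (n\<^sup>2 - n) = S\<close>.\<close>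
  define t where "t = (S / n - 1) / (n - 1)"
  have x: "x \<ge> 6" using assms by (simp add: x_def)
  have nx: "n = 1 + 3 * (x - 3) + 3 * (x - 3) * (x - 4) / 2 + (x - 3) * (x - 4) * (x - 5) / 6"
    unfolding n_def real_choose_three x_def[symmetric] by (simp add: field_simps)
  have "0 < 3 * (x - 3)" "0 \<le> 3 * (x - 3) * (x - 4) / 2" "0 \<le> (x - 3) * (x - 4) * (x - 5) / 6"
    using x by auto
  then have "0 < 3 * (x - 3) + 3 * (x - 3) * (x - 4) / 2 + (x - 3) * (x - 4) * (x - 5) / 6"
    by (intro add_pos_nonneg)
  then have n: "n > 1" unfolding nx by (simp only: add.assoc less_add_same_cancel1)
  have sum: "(\<Sum>i=1..k. real (m i)) = n" using total by (simp add: n_def flip: of_nat_sum)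
  have "n \<le> S"
    unfolding S_def sum[symmetric]
    using assms(2) by (intro sum_mono) (simp add: power2_eq_square Suc_le_eq)
  moreover have "S \<le> n\<^sup>2"
  proof -
    have "S \<le> (\<Sum>i=1..k. real (m i) * n)"
      unfolding S_def power2_eq_square
      by (intro sum_mono mult_left_mono) (auto simp: sum[symmetric] intro: member_le_sum)
    then show ?thesis by (simp only: sum_distrib_right[symmetric] sum power2_eq_square)
  qed
  ultimately have t: "0 \<le> t" "t \<le> 1" and tn: "t * (n - 1) = S / n - 1"
    using n by (auto simp: t_def field_simps power2_eq_square)
  \<comment> \<open>corresponds to \<open>Y = (1 - t) I + t J\<close>\<close>
  let ?y = "vector [t, t, t] :: real^3"
  have "scheme_eigenvalue x \<theta> (lp_profile ?y) = 1 - t"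
    if "\<theta> \<in> johnson_eigenvalues x - {3 * (x - 3)}" for \<theta>
  proof -
    \<comment> \<open>The three matrices add up to \<open>J - I\<close>, whose nontrivial eigenvalue
      is -1.\<close>
    have "\<theta> + eigen2 x \<theta> + eigen3 x \<theta> = - 1"
      using that unfolding johnson_eigenvalues_def
      by (elim DiffE insertE emptyE; simp only: eigen_eqs; simp add: field_simps power2_eq_square)
    moreover have "scheme_eigenvalue x \<theta> (lp_profile ?y) =
        1 + t * (\<theta> + eigen2 x \<theta> + eigen3 x \<theta>)"
      by (simp add: scheme_eigenvalue_def lp_profile_def distrib_left)
    ultimately have "scheme_eigenvalue x \<theta> (lp_profile ?y) = 1 + t * (- 1)"
      by (simp only:)
    then show ?thesis by simp
  qed
  moreover have "scheme_eigenvalue x (3 * (x - 3)) (lp_profile ?y) = S / n"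
  proof -
    have "scheme_eigenvalue x (3 * (x - 3)) (lp_profile ?y) = 1 + t * (n - 1)"
      unfolding scheme_eigenvalue_def lp_profile_def eigen_eqs nx by (simp add: algebra_simps)
    then show ?thesis using tn by simp
  qed
  moreover have "0 \<le> ?y" using t by (simp add: less_eq_vec_def forall_3)
  ultimately have "?y \<in> lp_feasible v k m"
    unfolding lp_feasible_iff[OF assms(1)] x_def[symmetric] n_def[symmetric] S_def[symmetric]
    using t by simp
  then show ?thesis by blast
qed

text \<open>For \<open>v \<ge> 6\<close> all coefficients of the equality are at least 1, so with
  \<open>y \<ge> 0\<close> it bounds every coordinate. Compactness is needed because an optimal
  value must be attained.\<close>

lemma compact_lp_feasible:
  assumes "v \<ge> 6"
  shows "compact (lp_feasible v k m)"
proof -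
  have "1 \<le> real ((v - 3) choose 2)" "1 \<le> real ((v - 3) choose 3)"
    using assms by (simp_all add: Suc_le_eq)
  then have "1 \<le> 3 * real ((v - 3) choose 2)" "1 \<le> real ((v - 3) choose 3)"
    by linarith+
  then have A: "1 \<le> lp_A_eq v $ i" for i
    using assms exhaust_3[of i] by (auto simp: lp_A_eq_def Suc_le_eq)
  have "y \<in> cbox 0 (\<chi> i. lp_b_eq v k m)" if "y \<in> lp_feasible v k m" for y
  proof -
    have y: "lp_A_eq v \<bullet> y = lp_b_eq v k m" "\<And>i. 0 \<le> y $ i"
      using that by (auto simp: lp_feasible_def less_eq_vec_def)
    have "y $ i \<le> lp_b_eq v k m" for i
    proof -
      have "y $ i \<le> lp_A_eq v $ i * y $ i" using A[of i] y(2)[of i] by (simp add: mult_le_cancel_right1)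
      also have "\<dots> \<le> (\<Sum>j\<in>UNIV. lp_A_eq v $ j * y $ j)"
        using A y(2) by (intro member_le_sum) (auto intro!: mult_nonneg_nonneg order_trans[OF zero_le_one A])
      finally show ?thesis using y(1) by (simp add: inner_vec_def)
    qed
    then show ?thesis using y(2) by (simp add: mem_box_cart)
  qed
  then have "bounded (lp_feasible v k m)"
    using bounded_subset[OF bounded_cbox] by blast
  moreover have "closed (lp_feasible v k m)"
    unfolding lp_feasible_def less_eq_vec_def matrix_vector_mult_def
    by (intro closed_Collect_conj closed_Collect_all closed_Collect_eq closed_Collect_le)
       (auto intro!: continuous_intros)
  ultimately show ?thesis by (simp add: compact_eq_bounded_closed)
qed

theorem theorem3:
  fixes \<Omega> :: "'a set" and v k :: nat and m :: "nat \<Rightarrow> nat" and vertex :: "'n::finite \<Rightarrow> 'a set"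
  assumes "finite \<Omega>" and "card \<Omega> = v" and "v \<ge> 6"
    and "bij_betw vertex UNIV (johnson_vertices \<Omega> 3)"
    and "k > 0" and "\<And>i. i \<in> {1..k} \<Longrightarrow> m i > 0"
    and "(\<Sum>i=1..k. m i) = v choose 3"
  shows "\<exists>z. is_GPPm (adjacency_matrix (\<lambda>i j. johnson_adj 3 (vertex i) (vertex j))) k m z \<and>
             is_optimal_value (lp_objective v) (lp_feasible v k m) z"
proof -
  interpret johnson3_labelling \<Omega> vertex
    using assms by unfold_locales auto
  let ?A = "adjacency_matrix (\<lambda>i j. johnson_adj 3 (vertex i) (vertex j))"
  have A: "?A = scheme_matrix (\<lambda>c. of_bool (c = 2))"
    using adjacency_eq_scheme_matrix by simp
  have "continuous_on (lp_feasible v k m) (lp_objective v)"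
    unfolding lp_objective_def by (intro continuous_intros)
  then obtain y where y: "y \<in> lp_feasible v k m"
      "\<And>y'. y' \<in> lp_feasible v k m \<Longrightarrow> lp_objective v y \<le> lp_objective v y'"
    using continuous_attains_inf[OF compact_lp_feasible[OF assms(3)]
        lp_feasible_nonempty[OF assms(3,6,7)]] by blast
  then have "is_optimal_value (lp_objective v) (lp_feasible v k m) (lp_objective v y)"
    by (auto simp: is_optimal_value_def)
  moreover have "scheme_matrix (lp_profile y) \<in> gpp_feasible k m"
    using lp_point_gives_gpp_point[of m k y] assms(2,7) y(1) by simp
  \<comment> \<open>Every feasible \<open>Y\<close> shares its objective value with some feasible
    point of the linear program, so the linear minimum is a lower bound here as well.\<close>
  then have "is_GPPm ?A k m (lp_objective v y)"
    unfolding is_GPPm_def is_optimal_value_def A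
    using gpp_objective_lp_profile[of y] gpp_point_gives_lp_point[OF assms(5), of _ m] y(2) assms(2)
    by metis
  ultimately show ?thesis by blast
qed

end
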